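(* Let $(L;\vee,\wedge,^{\Delta},0,1)$ be a weakly complemented lattice whose underlying lattice is distributive. For an S-filter $F$ of $L$ let $\theta_F=\{(x,y)\in L^2\mid \exists u\in F,\ x\vee u^{\Delta}=y\vee u^{\Delta}\}$. Then for any two S-filters $F_1,F_2$ of $L$, $\theta_{F_1}\circ\theta_{F_2}=\theta_{F_2}\circ\theta_{F_1}$ (relational product).
   Context: A weakly complemented lattice (WCL) is an algebra $(L;\vee,\wedge,^{\Delta},0,1)$ such that $(L;\wedge,\vee,0,1)$ is a bounded lattice and, for all $x,y\in L$: $x^{\Delta\Delta}\le x$; $x\le y\Rightarrow y^{\Delta}\le x^{\Delta}$; $(x\wedge y)\vee(x\wedge y^{\Delta})=x$. A filter is a nonempty upward closed subset closed under $\wedge$. With $x\,\overline{\sqcap}\,y=(x^{\Delta}\vee y^{\Delta})^{\Delta}$, an S-filter is a filter $F$ with $x\,\overline{\sqcap}\,y\in F$ whenever $x,y\in F$. The relational product is $\alpha\circ\beta=\{(x,y)\mid \exists z,\ (x,z)\in\alpha,\ (z,y)\in\beta\}$. *)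

theory Defs
  imports Main
begin

class weakly_complemented_lattice = bounded_lattice +
  fixes wcompl :: "'a \<Rightarrow> 'a"  ("(_\<^sup>\<Delta>)" [1000] 999)
  assumes wcompl_wcompl_le: "(x\<^sup>\<Delta>)\<^sup>\<Delta> \<le> x"
    and wcompl_antimono: "x \<le> y \<Longrightarrow> y\<^sup>\<Delta> \<le> x\<^sup>\<Delta>"
    and wcompl_decomp: "sup (inf x y) (inf x (y\<^sup>\<Delta>)) = x"

definition lattice_filter :: "'a::lattice set \<Rightarrow> bool" where
  "lattice_filter F \<longleftrightarrow> F \<noteq> {} \<and> (\<forall>x\<in>F. \<forall>y. x \<le> y \<longrightarrow> y \<in> F) \<and> (\<forall>x\<in>F. \<forall>y\<in>F. inf x y \<in> F)"

definition skeleton_meet :: "'a::weakly_complemented_lattice \<Rightarrow> 'a \<Rightarrow> 'a" where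
  "skeleton_meet x y = (sup (x\<^sup>\<Delta>) (y\<^sup>\<Delta>))\<^sup>\<Delta>"

definition S_filter :: "'a::weakly_complemented_lattice set \<Rightarrow> bool" where
  "S_filter F \<longleftrightarrow> lattice_filter F \<and> (\<forall>x\<in>F. \<forall>y\<in>F. skeleton_meet x y \<in> F)"

definition filter_rel :: "'a::weakly_complemented_lattice set \<Rightarrow> 'a rel" where
  "filter_rel F = {(x, y). \<exists>u\<in>F. sup x (u\<^sup>\<Delta>) = sup y (u\<^sup>\<Delta>)}"

end

theory Submission
  imports Defs
begin

text \<open>
  If \<open>x\<close> and \<open>y\<close> agree modulo \<open>sup a b\<close> in a distributive lattice, then
  \<open>inf (sup x b) (sup y a)\<close> agrees with \<open>x\<close> modulo \<open>b\<close> and with \<open>y\<close> modulo \<open>a\<close>.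
  Hence relations of the form "equal after joining with some element of a given set"
  always permute.
\<close>

lemma sup_congruence_interpolant:
  fixes x y a b :: "'a::distrib_lattice"
  assumes "sup x (sup a b) = sup y (sup a b)"
  shows "sup (inf (sup x b) (sup y a)) b = sup x b"
    and "sup (inf (sup x b) (sup y a)) a = sup y a"
proof -
  have "sup (inf (sup x b) (sup y a)) b = inf (sup x b) (sup y (sup a b))"
    by (simp only: sup_inf_distrib2 sup_assoc sup_idem)
  \<comment> \<open>Trading \<open>y\<close> for \<open>x\<close> puts the second factor above the
    first, so the meet collapses.\<close>
  also have "\<dots> = inf (sup x b) (sup x (sup a b))"
    by (simp only: assms)
  also have "\<dots> = sup x b"
    by (intro inf_absorb1 sup_mono) simp_all
  finally show "sup (inf (sup x b) (sup y a)) b = sup x b" .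
  have "sup (inf (sup x b) (sup y a)) a = inf (sup x (sup a b)) (sup y a)"
    by (simp only: sup_inf_distrib2 sup_assoc sup_idem sup_commute[of b a])
  also have "\<dots> = inf (sup y (sup a b)) (sup y a)"
    by (simp only: assms)
  also have "\<dots> = sup y a"
    by (intro inf_absorb2 sup_mono) simp_all
  finally show "sup (inf (sup x b) (sup y a)) a = sup y a" .
qed

text \<open>Exchanging \<open>F\<close> and \<open>G\<close> gives the reverse inclusion, so this
  one yields equality.\<close>

lemma filter_rel_relcomp_subset:
  fixes F G :: "'a::{weakly_complemented_lattice, distrib_lattice} set"
  shows "filter_rel F O filter_rel G \<subseteq> filter_rel G O filter_rel F"
proof (rule subrelI)
  fix x y
  assume "(x, y) \<in> filter_rel F O filter_rel G"
  then obtain z u v where u: "u \<in> F" and xz: "sup x (u\<^sup>\<Delta>) = sup z (u\<^sup>\<Delta>)"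
    and v: "v \<in> G" and zy: "sup z (v\<^sup>\<Delta>) = sup y (v\<^sup>\<Delta>)"
    unfolding filter_rel_def by blast
  \<comment> \<open>Agreement modulo \<open>u\<^sup>\<Delta>\<close> or
    \<open>v\<^sup>\<Delta>\<close> persists modulo their join, which links \<open>x\<close> to
    \<open>y\<close> through \<open>z\<close>.\<close>
  have "sup x (sup (u\<^sup>\<Delta>) (v\<^sup>\<Delta>)) = sup z (sup (u\<^sup>\<Delta>) (v\<^sup>\<Delta>))"
    by (simp only: sup_assoc[symmetric] xz)
  also have "\<dots> = sup y (sup (u\<^sup>\<Delta>) (v\<^sup>\<Delta>))"
    by (simp only: sup_commute[of "u\<^sup>\<Delta>"] sup_assoc[symmetric] zy)
  finally have "sup x (sup (u\<^sup>\<Delta>) (v\<^sup>\<Delta>)) = sup y (sup (u\<^sup>\<Delta>) (v\<^sup>\<Delta>))" .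
  note w = sup_congruence_interpolant[OF this]
  \<comment> \<open>The new midpoint is the interpolant for \<open>a = u\<^sup>\<Delta>\<close>,
    \<open>b = v\<^sup>\<Delta>\<close>: it agrees with \<open>x\<close> modulo the element coming
    from \<open>G\<close>, which reverses the order of the factors.\<close>
  let ?w = "inf (sup x (v\<^sup>\<Delta>)) (sup y (u\<^sup>\<Delta>))"
  have "(x, ?w) \<in> filter_rel G"
    unfolding filter_rel_def using v w(1)[symmetric] by blast
  moreover have "(?w, y) \<in> filter_rel F"
    unfolding filter_rel_def using u w(2) by blast
  ultimately show "(x, y) \<in> filter_rel G O filter_rel F"
    by blast
qed

theorem theorem6p5:
  fixes F1 F2 :: "'a::{weakly_complemented_lattice, distrib_lattice} set"
  assumes "S_filter F1" and "S_filter F2"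
  shows "filter_rel F1 O filter_rel F2 = filter_rel F2 O filter_rel F1"
  by (intro equalityI filter_rel_relcomp_subset)

end
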